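(* Let $C$ be a proper convex subset of $\mathbb R^m$, $m\in\mathbb N$. Then the sets $S_C$ and $\bigcup_{F\in\mathcal L_C\setminus\{C\}}F$ are disjoint. Moreover, $C\in\mathcal C_m^0$ if and only if the boundary $C\setminus\operatorname{int}(C)$ of $C$ is the union of the smooth coatoms of $\mathcal E_C$.
   Context: $\mathbb R^m$ carries the standard inner product $\langle\cdot,\cdot\rangle$. The relative interior of a convex set is its interior in its affine hull. For a convex set $C\subset\mathbb R^m$ the normal cone of $C$ at $x\in C$ is $N_C(x):=\{u\in\mathbb R^m\mid \forall y\in C:\ \langle u,y-x\rangle\le 0\}$. For a non-empty convex subset $F\subset C$, $N_C(F):=N_C(x)$ for any relative interior point $x$ of $F$ (well-defined), and $N_C(\emptyset):=\mathbb R^m$. $\mathcal N_C$ denotes the set of normal cones of $C$ at points of $C$ together with $N_C(\emptyset)=\mathbb R^m$. A proper normal cone of $C$ is an element of $\mathcal N_C$ other than $N_C(\emptyset)$ and $N_C(C)$. An exposed face of a convex set is either the empty set or the set of minimizers of a linear form on it (the zero form is allowed, so the whole set is an exposed face). $\mathcal E_C$ is the set of exposed faces of $C$; ordered by inclusion it is a complete lattice with intersection as infimum. A proper exposed face of $C$ is an $F\in\mathcal E_C$ with $F\ne\emptyset$ and $F\ne C$. A proper convex subset of $\mathbb R^m$ is a convex subset of $\mathbb R^m$ with interior points which has a proper exposed face. A coatom of $\mathcal E_C$ is an inclusion-maximal element of $\mathcal E_C\setminus\{C\}$. A ray is a set $\{\alpha u\mid\alpha\ge0\}$ with $u\neq0$;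 an exposed ray of a convex cone is an exposed face of it which is a ray. An exposed face $F$ of $C$ is smooth if $N_C(F)$ is a ray (a smooth coatom of $\mathcal E_C$ is a coatom which is a smooth exposed face). An exposed point of $C$ is a point $s$ such that $\{s\}\in\mathcal E_C$; it is a smooth exposed point if moreover $N_C(s)$ is one-dimensional. $\mathcal C_m^0$ is the class of proper convex subsets $C$ of $\mathbb R^m$ such that every proper normal cone $N$ of $C$ has an exposed ray which is in $\mathcal N_C$. $S_C:=\{s\in C\mid s\text{ is a smooth exposed point of }C\}$. A sublattice of a lattice is a subset closed under the binary infimum and supremum of that lattice; the sublattice generated by a subset $X$ is the smallest sublattice containing $X$. $\mathcal L_C$ is the sublattice of $\mathcal E_C$ generated by $\{\emptyset,C\}$ together with the smooth coatoms of $\mathcal E_C$ which are not singletons. *)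

theory Defs
  imports "HOL-Analysis.Analysis"
begin

text \<open>
  Exposed faces are those of the library, where the empty set always counts as exposed. On convex
  sets they are the empty set and the sets of minimizers of linear forms:
\<close>

lemma exposed_face_of_iff_minimizers:
  fixes C :: "'a::euclidean_space set"
  assumes "convex C"
  shows "F exposed_face_of C \<longleftrightarrow> F = {} \<or> (\<exists>a. F = {x \<in> C. \<forall>y\<in>C. a \<bullet> x \<le> a \<bullet> y})"
proof
  assume "F exposed_face_of C"
  then obtain a b where ab: "C \<subseteq> {x. a \<bullet> x \<le> b}" "F = C \<inter> {x. a \<bullet> x = b}"
    unfolding exposed_face_of_def by blast
  show "F = {} \<or> (\<exists>a. F = {x \<in> C. \<forall>y\<in>C. a \<bullet> x \<le> a \<bullet> y})"
  proof (cases "F = {}")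
    case False
    then obtain z where z: "z \<in> C" "a \<bullet> z = b" using ab by blast
    have "F = {x \<in> C. \<forall>y\<in>C. (-a) \<bullet> x \<le> (-a) \<bullet> y}"
      using ab z by (auto simp: subset_iff intro: antisym)
    then show ?thesis by blast
  qed simp
next
  assume "F = {} \<or> (\<exists>a. F = {x \<in> C. \<forall>y\<in>C. a \<bullet> x \<le> a \<bullet> y})"
  then show "F exposed_face_of C"
  proof (elim disjE exE)
    fix a assume F: "F = {x \<in> C. \<forall>y\<in>C. a \<bullet> x \<le> a \<bullet> y}"
    show ?thesis
    proof (cases "F = {}")
      case False
      then obtain z where z: "z \<in> C" "\<forall>y\<in>C. a \<bullet> z \<le> a \<bullet> y" using F by blast
      have "F = C \<inter> {x. a \<bullet> x = a \<bullet> z}"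
        using F z by (auto intro: antisym)
      then show ?thesis
        using z by (auto intro!: exposed_face_of_Int_supporting_hyperplane_ge[OF assms])
    qed simp
  qed simp
qed

definition exposed_faces :: "'a::euclidean_space set \<Rightarrow> 'a set set" where
  "exposed_faces C = {F. F exposed_face_of C}"

definition proper_exposed_face :: "'a::euclidean_space set \<Rightarrow> 'a set \<Rightarrow> bool" where
  "proper_exposed_face C F \<longleftrightarrow> F \<in> exposed_faces C \<and> F \<noteq> {} \<and> F \<noteq> C"

definition proper_convex :: "'a::euclidean_space set \<Rightarrow> bool" where
  "proper_convex C \<longleftrightarrow> convex C \<and> interior C \<noteq> {} \<and> (\<exists>F. proper_exposed_face C F)"

definition coatom :: "'a::euclidean_space set \<Rightarrow> 'a set \<Rightarrow> bool" where
  "coatom C F \<longleftrightarrow>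
     F \<in> exposed_faces C - {C} \<and> (\<forall>G \<in> exposed_faces C - {C}. F \<subseteq> G \<longrightarrow> G = F)"

text \<open>
  The infimum of exposed faces is their intersection. Their supremum is in general larger than
  the union: it is the smallest exposed face that contains them.
\<close>

definition exposed_sup :: "'a::euclidean_space set \<Rightarrow> 'a set \<Rightarrow> 'a set \<Rightarrow> 'a set" where
  "exposed_sup C F G = \<Inter>{H \<in> exposed_faces C. F \<subseteq> H \<and> G \<subseteq> H}"

lemma exposed_sup_is_supremum:
  assumes "convex C" "F \<in> exposed_faces C" "G \<in> exposed_faces C"
  shows "exposed_sup C F G \<in> exposed_faces C"
    and "F \<subseteq> exposed_sup C F G" and "G \<subseteq> exposed_sup C F G"
    and "\<And>H. \<lbrakk>H \<in> exposed_faces C; F \<subseteq> H; G \<subseteq> H\<rbrakk> \<Longrightarrow> exposed_sup C F G \<subseteq> H"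
proof -
  have "C \<in> {H \<in> exposed_faces C. F \<subseteq> H \<and> G \<subseteq> H}"
    using assms exposed_face_of_refl[of C]
    by (simp add: exposed_faces_def) (simp add: exposed_face_of_def face_of_imp_subset)
  then have "\<Inter>{H \<in> exposed_faces C. F \<subseteq> H \<and> G \<subseteq> H} exposed_face_of C"
    by (intro exposed_face_of_Inter) (auto simp: exposed_faces_def)
  then show "exposed_sup C F G \<in> exposed_faces C"
    by (simp add: exposed_sup_def exposed_faces_def)
qed (auto simp: exposed_sup_def)

definition exposed_sublattice :: "'a::euclidean_space set \<Rightarrow> 'a set set \<Rightarrow> bool" where
  "exposed_sublattice C L \<longleftrightarrow>
     L \<subseteq> exposed_faces C \<and> (\<forall>F\<in>L. \<forall>G\<in>L. F \<inter> G \<in> L \<and> exposed_sup C F G \<in> L)"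

definition generated_sublattice :: "'a::euclidean_space set \<Rightarrow> 'a set set \<Rightarrow> 'a set set" where
  "generated_sublattice C X = \<Inter>{L. exposed_sublattice C L \<and> X \<subseteq> L}"

definition normal_cone_at :: "'a::euclidean_space set \<Rightarrow> 'a \<Rightarrow> 'a set" where
  "normal_cone_at C x = {u. \<forall>y\<in>C. u \<bullet> (y - x) \<le> 0}"

definition normal_cone :: "'a::euclidean_space set \<Rightarrow> 'a set \<Rightarrow> 'a set" where
  "normal_cone C F =
     (if F = {} then UNIV else normal_cone_at C (SOME x. x \<in> rel_interior F))"

lemma normal_cone_at_rel_interior_mono:
  fixes C :: "'a::euclidean_space set"
  assumes "convex F" "F \<subseteq> C" "x \<in> rel_interior F" "y \<in> F"
  shows "normal_cone_at C x \<subseteq> normal_cone_at C y"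
proof
  fix u assume u: "u \<in> normal_cone_at C x"
  obtain e where e: "e > 1" "(1 - e) *\<^sub>R y + e *\<^sub>R x \<in> F"
    using convex_rel_interior_iff[OF assms(1), of x] assms(3,4) by blast
  have "u \<bullet> ((1 - e) *\<^sub>R y + e *\<^sub>R x - x) \<le> 0"
    using u e(2) assms(2) by (auto simp: normal_cone_at_def)
  moreover have "(1 - e) *\<^sub>R y + e *\<^sub>R x - x = (e - 1) *\<^sub>R (x - y)"
    by (simp add: algebra_simps)
  ultimately have "u \<bullet> (x - y) \<le> 0"
    using e(1) by (simp add: mult_le_0_iff)
  moreover have "\<forall>z\<in>C. u \<bullet> (z - x) \<le> 0"
    using u by (simp add: normal_cone_at_def)
  ultimately show "u \<in> normal_cone_at C y"
    by (force simp: normal_cone_at_def inner_diff_right)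
qed

text \<open>The choice in \<open>normal_cone\<close> is immaterial:\<close>

lemma normal_cone_eq_normal_cone_at:
  fixes C :: "'a::euclidean_space set"
  assumes "convex F" "F \<subseteq> C" "x \<in> rel_interior F"
  shows "normal_cone C F = normal_cone_at C x"
proof -
  have *: "(SOME x. x \<in> rel_interior F) \<in> rel_interior F"
    using assms(3) by (rule someI)
  have sub: "rel_interior F \<subseteq> F" by (rule rel_interior_subset)
  have "F \<noteq> {}" using assms(3) sub by blast
  moreover have "normal_cone_at C (SOME x. x \<in> rel_interior F) = normal_cone_at C x"
    using normal_cone_at_rel_interior_mono[OF assms(1,2)] * assms(3) sub by blast
  ultimately show ?thesis by (simp add: normal_cone_def)
qed

definition normal_cones :: "'a::euclidean_space set \<Rightarrow> 'a set set" where
  "normal_cones C = insert (normal_cone C {}) (normal_cone_at C ` C)"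

definition proper_normal_cone :: "'a::euclidean_space set \<Rightarrow> 'a set \<Rightarrow> bool" where
  "proper_normal_cone C N \<longleftrightarrow>
     N \<in> normal_cones C \<and> N \<noteq> normal_cone C {} \<and> N \<noteq> normal_cone C C"

definition ray :: "'a::euclidean_space set \<Rightarrow> bool" where
  "ray R \<longleftrightarrow> (\<exists>u. u \<noteq> 0 \<and> R = {\<alpha> *\<^sub>R u | \<alpha>. \<alpha> \<ge> 0})"

definition exposed_ray :: "'a::euclidean_space set \<Rightarrow> 'a set \<Rightarrow> bool" where
  "exposed_ray K R \<longleftrightarrow> R exposed_face_of K \<and> ray R"

text \<open>
  The class \<open>C\<^sub>m\<^sup>0\<close>; the dimension \<open>m\<close> is the dimension of the ambient space, i.e. of the type.
\<close>

definition class_C0 :: "'a::euclidean_space set \<Rightarrow> bool" where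
  "class_C0 C \<longleftrightarrow> proper_convex C \<and>
     (\<forall>N. proper_normal_cone C N \<longrightarrow> (\<exists>R. exposed_ray N R \<and> R \<in> normal_cones C))"

definition smooth_exposed_face :: "'a::euclidean_space set \<Rightarrow> 'a set \<Rightarrow> bool" where
  "smooth_exposed_face C F \<longleftrightarrow> F \<in> exposed_faces C \<and> ray (normal_cone C F)"

definition smooth_coatoms :: "'a::euclidean_space set \<Rightarrow> 'a set set" where
  "smooth_coatoms C = {F. coatom C F \<and> smooth_exposed_face C F}"

definition smooth_exposed_points :: "'a::euclidean_space set \<Rightarrow> 'a set" where
  "smooth_exposed_points C =
     {s \<in> C. {s} \<in> exposed_faces C \<and> aff_dim (normal_cone_at C s) = 1}"

definition smooth_lattice :: "'a::euclidean_space set \<Rightarrow> 'a set set" where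
  "smooth_lattice C =
     generated_sublattice C ({{}, C} \<union> {F \<in> smooth_coatoms C. \<not> is_singleton F})"

end

theory Submission
  imports Defs
begin

text \<open>
  Everything rests on one duality: a vector \<open>u\<close> is normal to \<open>C\<close> at \<open>x\<close> exactly when \<open>x\<close> lies in the
  exposed face \<open>exposed_by C u\<close> on which \<open>u\<close> is maximal. Since \<open>C\<close> has interior points, its normal
  cones at points of \<open>C\<close> contain no line, and the exposed faces other than \<open>{}\<close> and \<open>C\<close> are the
  non-empty sets \<open>exposed_by C u\<close> with \<open>u \<noteq> 0\<close>. Hence if all non-zero normal vectors at \<open>x\<close> are
  positive multiples of a single \<open>u\<close>, then \<open>exposed_by C u\<close> is the only exposed face other than \<open>C\<close>
  that contains \<open>x\<close>.

  At a smooth exposed point \<open>s\<close> this unique face is \<open>{s}\<close>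
  (\<open>exposed_face_through_smooth_exposed_point\<close>). So no generator of the lattice other than \<open>C\<close>
  contains \<open>s\<close>, and a supremum of faces avoiding \<open>s\<close> can contain \<open>s\<close> only by being all of \<open>C\<close>:
  the faces avoiding \<open>s\<close>, together with \<open>C\<close>, form a sublattice.

  For the equivalence, the proper normal cones are the normal cones at boundary points of \<open>C\<close>
  (\<open>proper_normal_cone_iff\<close>). If \<open>N\<close> is the normal cone at \<open>x\<close> and a smooth coatom contains \<open>x\<close>, the
  normal cone of the coatom is a ray and an exposed face of \<open>N\<close>
  (\<open>normal_cone_at_exposed_face_of_normal_cone_at\<close>). Conversely, if \<open>N\<close> contains a ray generated by
  \<open>u\<close> that is itself the normal cone at some point \<open>y\<close> of \<open>C\<close>, then \<open>exposed_by C u\<close> contains both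
  \<open>x\<close> and \<open>y\<close>, and \<open>y\<close> witnesses that it is a smooth coatom
  (\<open>exposed_by_ray_smooth_coatom\<close>).
\<close>


section \<open>Normal vectors and the faces they expose\<close>

definition exposed_by :: "'a::euclidean_space set \<Rightarrow> 'a \<Rightarrow> 'a set" where
  "exposed_by C u = {x \<in> C. u \<in> normal_cone_at C x}"

lemma exposed_by_exposed_face_of:
  assumes "convex C"
  shows "exposed_by C u exposed_face_of C"
proof -
  have "exposed_by C u = {x \<in> C. \<forall>y\<in>C. (- u) \<bullet> x \<le> (- u) \<bullet> y}"
    by (auto simp: exposed_by_def normal_cone_at_def inner_diff_right)
  then show ?thesis
    using exposed_face_of_iff_minimizers[OF assms] by blast
qed

lemma exposed_by_scaleR:
  assumes "c > 0"
  shows "exposed_by C (c *\<^sub>R u) = exposed_by C u"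
  using assms by (auto simp: exposed_by_def normal_cone_at_def mult_le_0_iff)

lemma proper_exposed_face_eq_exposed_by:
  assumes "F exposed_face_of C" "F \<noteq> {}" "F \<noteq> C"
  obtains u where "u \<noteq> 0" "F = exposed_by C u"
proof -
  obtain a b where ab: "C \<subseteq> {x. a \<bullet> x \<le> b}" "F = C \<inter> {x. a \<bullet> x = b}"
    using assms(1) unfolding exposed_face_of_def by blast
  obtain z where z: "z \<in> C" "a \<bullet> z = b" using assms(2) ab(2) by blast
  have "a \<noteq> 0" using assms(3) ab(2) z by auto
  moreover have "F = exposed_by C a"
  proof (intro set_eqI iffI)
    fix x assume "x \<in> F"
    then show "x \<in> exposed_by C a"
      using ab by (auto simp: exposed_by_def normal_cone_at_def inner_diff_right)
  next
    fix x assume "x \<in> exposed_by C a"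
    then have x: "x \<in> C" "a \<bullet> z \<le> a \<bullet> x"
      using z(1) by (auto simp: exposed_by_def normal_cone_at_def inner_diff_right)
    then have "a \<bullet> x = b" using ab(1) z(2) by force
    then show "x \<in> F" using x(1) ab(2) by simp
  qed
  ultimately show thesis using that by blast
qed

lemma zero_in_normal_cone_at: "0 \<in> normal_cone_at C x"
  by (simp add: normal_cone_at_def)

lemma scaleR_in_normal_cone_at:
  assumes "u \<in> normal_cone_at C x" "c \<ge> 0"
  shows "c *\<^sub>R u \<in> normal_cone_at C x"
  using assms by (auto simp: normal_cone_at_def mult_le_0_iff)

lemma convex_normal_cone_at: "convex (normal_cone_at C x)"
  by (auto simp: convex_def normal_cone_at_def inner_add_left
      intro!: add_nonpos_nonpos mult_nonneg_nonpos)

lemma normal_vector_at_interior_point: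
  assumes "x \<in> interior C" "u \<in> normal_cone_at C x"
  shows "u = 0"
proof (rule ccontr)
  assume "u \<noteq> 0"
  obtain e where e: "e > 0" "cball x e \<subseteq> C"
    using assms(1) by (auto simp: mem_interior_cball)
  have "x + (e / norm u) *\<^sub>R u \<in> C"
    using e \<open>u \<noteq> 0\<close> by (intro subsetD[OF e(2)]) (simp add: dist_norm)
  then have "u \<bullet> ((e / norm u) *\<^sub>R u) \<le> 0"
    using assms(2) by (force simp: normal_cone_at_def)
  moreover have "u \<bullet> u > 0" using \<open>u \<noteq> 0\<close> by simp
  ultimately show False
    using e(1) \<open>u \<noteq> 0\<close> by (simp add: divide_le_0_iff mult_le_0_iff del: inner_gt_zero_iff)
qed

text \<open>
  If \<open>u\<close> and \<open>- u\<close> are both normal, the form given by \<open>u\<close> is constant on \<open>C\<close>, so \<open>u\<close> is also normal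
  at interior points.
\<close>

lemma normal_cone_at_pointed:
  assumes "interior C \<noteq> {}" "u \<in> normal_cone_at C x" "- u \<in> normal_cone_at C x"
  shows "u = 0"
proof -
  obtain z where z: "z \<in> interior C" using assms(1) by blast
  have eq: "u \<bullet> y = u \<bullet> x" if "y \<in> C" for y
    using assms(2,3) that by (force simp: normal_cone_at_def inner_diff_right)
  have "u \<in> normal_cone_at C z"
    using eq z interior_subset[of C] by (force simp: normal_cone_at_def inner_diff_right)
  then show ?thesis using normal_vector_at_interior_point z by blast
qed

lemma normal_cone_at_neq_UNIV:
  fixes C :: "'a::euclidean_space set"
  assumes "interior C \<noteq> {}"
  shows "normal_cone_at C x \<noteq> UNIV"
proof
  assume "normal_cone_at C x = UNIV"
  then show False
    using normal_cone_at_pointed[OF assms, of "SOME b. b \<in> Basis" x] some_in_eq[of Basis]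
    by (auto dest: nonzero_Basis)
qed

lemma normal_cone_at_eq_zero_iff:
  fixes C :: "'a::euclidean_space set"
  assumes "convex C" "interior C \<noteq> {}" "x \<in> C"
  shows "normal_cone_at C x = {0} \<longleftrightarrow> x \<in> interior C"
proof
  assume N: "normal_cone_at C x = {0}"
  show "x \<in> interior C"
  proof (rule ccontr)
    assume "x \<notin> interior C"
    then have "x \<notin> rel_interior C"
      by (simp add: rel_interior_nonempty_interior[OF assms(2)])
    then obtain a where a: "a \<noteq> 0" "\<And>y. y \<in> C \<Longrightarrow> a \<bullet> x \<le> a \<bullet> y"
      using supporting_hyperplane_rel_boundary[OF assms(1,3)] by metis
    then have "- a \<in> normal_cone_at C x"
      by (auto simp: normal_cone_at_def inner_diff_right)
    then show False using a(1) N by auto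
  qed
qed (use normal_vector_at_interior_point zero_in_normal_cone_at in blast)

lemma normal_cone_eq_at_point:
  assumes "convex F" "F \<subseteq> C" "F \<noteq> {}"
  obtains y where "y \<in> F" "normal_cone C F = normal_cone_at C y"
    "\<And>x. x \<in> F \<Longrightarrow> normal_cone_at C y \<subseteq> normal_cone_at C x"
proof -
  obtain y where y: "y \<in> rel_interior F"
    using rel_interior_eq_empty[OF assms(1)] assms(3) by blast
  show thesis
    using that[of y] y normal_cone_eq_normal_cone_at[OF assms(1,2) y]
      normal_cone_at_rel_interior_mono[OF assms(1,2) y] rel_interior_subset[of F] by blast
qed

lemma proper_normal_cone_iff:
  fixes C :: "'a::euclidean_space set"
  assumes "convex C" "interior C \<noteq> {}"
  shows "proper_normal_cone C N \<longleftrightarrow> (\<exists>x\<in>C - interior C. N = normal_cone_at C x)"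
proof -
  obtain z where z: "z \<in> interior C" using assms(2) by blast
  have "normal_cone C C = normal_cone_at C z"
    using z assms by (intro normal_cone_eq_normal_cone_at)
      (auto simp: rel_interior_nonempty_interior)
  then have whole: "normal_cone C C = {0}"
    using normal_cone_at_eq_zero_iff[OF assms] z interior_subset by blast
  have empty: "normal_cone C {} = UNIV" by (simp add: normal_cone_def)
  show ?thesis
    unfolding proper_normal_cone_def normal_cones_def whole empty
    using normal_cone_at_eq_zero_iff[OF assms] normal_cone_at_neq_UNIV[OF assms(2)] by blast
qed

lemma proper_exposed_face_disjoint_interior:
  assumes "F exposed_face_of C" "F \<noteq> C" "x \<in> F"
  shows "x \<in> C - interior C"
proof -
  obtain u where "u \<noteq> 0" "F = exposed_by C u"
    using proper_exposed_face_eq_exposed_by assms by blast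
  then show ?thesis
    using assms(3) normal_vector_at_interior_point by (auto simp: exposed_by_def)
qed


section \<open>Smooth exposed points\<close>

text \<open>
  A normal vector exposing \<open>{s}\<close> spans the one-dimensional normal cone at \<open>s\<close>, and by pointedness
  any other non-zero normal vector is a positive multiple of it, so it exposes the same face.
\<close>

lemma exposed_face_through_smooth_exposed_point:
  fixes C :: "'a::euclidean_space set"
  assumes "interior C \<noteq> {}" "s \<in> smooth_exposed_points C"
    and "F exposed_face_of C" "F \<noteq> C" "s \<in> F"
  shows "F = {s}"
proof -
  let ?N = "normal_cone_at C s"
  have s: "s \<in> C" "{s} exposed_face_of C" "aff_dim ?N = 1"
    using assms(2) by (auto simp: smooth_exposed_points_def exposed_faces_def)
  have "{s} \<noteq> C" using assms(1) by auto
  then obtain v where v: "v \<noteq> 0" "{s} = exposed_by C v"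
    using proper_exposed_face_eq_exposed_by[OF s(2)] by blast
  obtain u where u: "u \<noteq> 0" "F = exposed_by C u"
    using proper_exposed_face_eq_exposed_by assms(3-5) by blast
  have vN: "v \<in> ?N" and uN: "u \<in> ?N"
    using v(2) u(2) assms(5) by (auto simp: exposed_by_def)
  have "dim ?N = 1"
    using s(3) aff_dim_zero[of ?N] hull_inc[OF zero_in_normal_cone_at] by force
  then have "?N \<subseteq> span {v}"
    using v(1) vN by (intro card_ge_dim_independent) auto
  then obtain c where c: "u = c *\<^sub>R v"
    using uN by (auto simp: span_singleton)
  have "c > 0"
  proof (rule ccontr)
    assume "\<not> c > 0"
    then have "- u \<in> ?N"
      using scaleR_in_normal_cone_at[OF vN, of "- c"] c by simp
    then show False using normal_cone_at_pointed[OF assms(1) uN] u(1) by blast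
  qed
  then show ?thesis using u(2) v(2) c exposed_by_scaleR by metis
qed

lemma exposed_sublattice_avoiding_smooth_exposed_point:
  fixes C :: "'a::euclidean_space set"
  assumes "convex C" "interior C \<noteq> {}" "s \<in> smooth_exposed_points C"
  shows "exposed_sublattice C (insert C {F \<in> exposed_faces C. s \<notin> F})" (is "exposed_sublattice C ?L")
proof -
  have C: "C \<in> exposed_faces C" using assms(1) by (simp add: exposed_faces_def)
  have s: "s \<in> C" using assms(3) by (simp add: smooth_exposed_points_def)
  have sub: "F \<subseteq> C" if "F \<in> exposed_faces C" for F
    using that by (auto simp: exposed_faces_def exposed_face_of_def face_of_imp_subset)
  have inter: "F \<inter> G \<in> ?L" if "F \<in> ?L" "G \<in> ?L" for F G
    using that sub C by (auto simp: exposed_faces_def exposed_face_of_Int)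
  have sup: "exposed_sup C F G \<in> ?L" if FG: "F \<in> ?L" "G \<in> ?L" for F G
  proof (rule ccontr)
    let ?H = "exposed_sup C F G"
    assume H: "?H \<notin> ?L"
    have FG': "F \<in> exposed_faces C" "G \<in> exposed_faces C" using FG C by auto
    note sup = exposed_sup_is_supremum[OF assms(1) FG']
    have "?H = {s}"
      using exposed_face_through_smooth_exposed_point[OF assms(2,3)] H sup(1)
      by (auto simp: exposed_faces_def)
    \<comment> \<open>Then neither \<open>F\<close> nor \<open>G\<close> is \<open>C\<close>, so both avoid \<open>s\<close> and are empty, as is their supremum.\<close>
    moreover have "?H \<noteq> C" using H by auto
    ultimately have "F = {}" "G = {}" using sup(2,3) FG by auto
    then have "?H = {}" by (auto simp: exposed_sup_def exposed_faces_def)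
    then show False using \<open>?H = {s}\<close> by simp
  qed
  show ?thesis
    unfolding exposed_sublattice_def
  proof (intro conjI ballI)
    show "?L \<subseteq> exposed_faces C" using C by auto
  qed (rule inter sup; assumption)+
qed

lemma smooth_exposed_points_disjoint_smooth_lattice:
  fixes C :: "'a::euclidean_space set"
  assumes "convex C" "interior C \<noteq> {}"
  shows "smooth_exposed_points C \<inter> \<Union>(smooth_lattice C - {C}) = {}"
proof -
  have False if s: "s \<in> smooth_exposed_points C" and F: "F \<in> smooth_lattice C" "F \<noteq> C" "s \<in> F"
    for s F
  proof -
    have "{{}, C} \<union> {F \<in> smooth_coatoms C. \<not> is_singleton F}
        \<subseteq> insert C {F \<in> exposed_faces C. s \<notin> F}"
      using exposed_face_through_smooth_exposed_point[OF assms(2) s]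
      by (auto simp: smooth_coatoms_def coatom_def exposed_faces_def is_singleton_def)
    then have "F \<in> insert C {F \<in> exposed_faces C. s \<notin> F}"
      using F(1) exposed_sublattice_avoiding_smooth_exposed_point[OF assms s]
      by (auto simp: smooth_lattice_def generated_sublattice_def)
    then show False using F(2,3) by blast
  qed
  then show ?thesis by blast
qed


section \<open>Smooth coatoms and exposed rays of normal cones\<close>

text \<open>
  The form given by \<open>y - x\<close> is non-positive on the normal cone at \<open>x\<close>, and it vanishes exactly at
  those normal vectors whose exposed face also contains \<open>y\<close>.
\<close>

lemma normal_cone_at_exposed_face_of_normal_cone_at:
  assumes "y \<in> C" "normal_cone_at C y \<subseteq> normal_cone_at C x" "x \<in> C"
  shows "normal_cone_at C y exposed_face_of normal_cone_at C x"
proof -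
  have le: "(y - x) \<bullet> u \<le> 0" if "u \<in> normal_cone_at C x" for u
    using that assms(1) by (simp add: normal_cone_at_def inner_commute)
  have "(y - x) \<bullet> u = 0" if "u \<in> normal_cone_at C y" for u
  proof -
    have "u \<bullet> (x - y) \<le> 0" using that assms(3) by (simp add: normal_cone_at_def)
    then show ?thesis
      using le[of u] that assms(2) by (auto simp: inner_diff_left inner_diff_right inner_commute)
  qed
  moreover have "u \<in> normal_cone_at C y" if "u \<in> normal_cone_at C x" "(y - x) \<bullet> u = 0" for u
    using that by (auto simp: normal_cone_at_def inner_diff_left inner_diff_right inner_commute)
  ultimately have "normal_cone_at C y = normal_cone_at C x \<inter> {u. (y - x) \<bullet> u = 0}"
    using assms(2) by blast
  then show ?thesis
    using exposed_face_of_Int_supporting_hyperplane_le[OF convex_normal_cone_at le] by metis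
qed

text \<open>
  The face exposed by \<open>u\<close> contains \<open>y\<close>, so every normal vector of this face, or of a larger face, is
  normal at \<open>y\<close> and hence a multiple of \<open>u\<close>.
\<close>

lemma exposed_by_ray_smooth_coatom:
  fixes C :: "'a::euclidean_space set"
  assumes "convex C" "interior C \<noteq> {}" "y \<in> C"
    and "u \<noteq> 0" and N: "normal_cone_at C y = {\<alpha> *\<^sub>R u | \<alpha>. \<alpha> \<ge> 0}"
  shows "exposed_by C u \<in> smooth_coatoms C"
proof -
  let ?F = "exposed_by C u"
  have F: "?F exposed_face_of C" using exposed_by_exposed_face_of[OF assms(1)] .
  have "u \<in> normal_cone_at C y"
    unfolding N using scaleR_one[of u] zero_le_one by (metis (mono_tags, lifting) mem_Collect_eq)
  then have y: "y \<in> ?F" using assms(3) by (simp add: exposed_by_def)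
  have F': "convex ?F" "?F \<subseteq> C" "?F \<noteq> {}"
    using F y by (auto simp: exposed_face_of_def face_of_imp_convex face_of_imp_subset)
  obtain z where z: "z \<in> ?F" "normal_cone C ?F = normal_cone_at C z"
    and mono: "\<And>x. x \<in> ?F \<Longrightarrow> normal_cone_at C z \<subseteq> normal_cone_at C x"
    by (rule normal_cone_eq_at_point[OF F']) blast
  have "u \<in> normal_cone_at C z" using z(1) by (simp add: exposed_by_def)
  then have "normal_cone_at C y \<subseteq> normal_cone_at C z"
    using scaleR_in_normal_cone_at by (auto simp: N)
  then have "normal_cone C ?F = {\<alpha> *\<^sub>R u | \<alpha>. \<alpha> \<ge> 0}" using z(2) mono[OF y] N by blast
  then have smooth: "smooth_exposed_face C ?F"
    using F assms(4) by (auto simp: smooth_exposed_face_def exposed_faces_def ray_def)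
  have "?F \<noteq> C"
    using normal_vector_at_interior_point[of _ C u] assms(2,4) interior_subset[of C]
    by (auto simp: exposed_by_def)
  moreover have "G = ?F" if G: "G exposed_face_of C" "G \<noteq> C" "?F \<subseteq> G" for G
  proof -
    obtain v where v: "v \<noteq> 0" "G = exposed_by C v"
      using proper_exposed_face_eq_exposed_by[of G C] G y by blast
    then have "v \<in> normal_cone_at C y" using G(3) y by (auto simp: exposed_by_def)
    then obtain c where "v = c *\<^sub>R u" "c \<ge> 0" unfolding N by blast
    then show ?thesis using v exposed_by_scaleR[of c C u] by (cases "c = 0") auto
  qed
  ultimately show ?thesis
    using F smooth by (auto simp: smooth_coatoms_def coatom_def exposed_faces_def)
qed

lemma class_C0_imp_boundary_eq_Union_smooth_coatoms:
  fixes C :: "'a::euclidean_space set"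
  assumes "class_C0 C"
  shows "C - interior C = \<Union>(smooth_coatoms C)"
proof
  have C: "convex C" "interior C \<noteq> {}"
    using assms by (auto simp: class_C0_def proper_convex_def)
  show "\<Union>(smooth_coatoms C) \<subseteq> C - interior C"
    using proper_exposed_face_disjoint_interior
    by (fastforce simp: smooth_coatoms_def coatom_def exposed_faces_def)
  show "C - interior C \<subseteq> \<Union>(smooth_coatoms C)"
  proof
    fix x assume x: "x \<in> C - interior C"
    then have "proper_normal_cone C (normal_cone_at C x)"
      using proper_normal_cone_iff[OF C] by blast
    then obtain R where R: "exposed_ray (normal_cone_at C x) R" "R \<in> normal_cones C"
      using assms by (auto simp: class_C0_def)
    then obtain u where u: "u \<noteq> 0" "R = {\<alpha> *\<^sub>R u | \<alpha>. \<alpha> \<ge> 0}"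
      by (auto simp: exposed_ray_def ray_def)
    have sub: "R \<subseteq> normal_cone_at C x"
      using R(1) by (auto simp: exposed_ray_def exposed_face_of_def face_of_imp_subset)
    then have "R \<noteq> UNIV" using normal_cone_at_neq_UNIV[OF C(2), of x] by auto
    then obtain y where y: "y \<in> C" "R = normal_cone_at C y"
      using R(2) by (auto simp: normal_cones_def normal_cone_def)
    have "u \<in> R"
      unfolding u(2) using scaleR_one[of u] zero_le_one
      by (metis (mono_tags, lifting) mem_Collect_eq)
    then have "x \<in> exposed_by C u" using sub x by (auto simp: exposed_by_def)
    then show "x \<in> \<Union>(smooth_coatoms C)"
      using exposed_by_ray_smooth_coatom[OF C y(1) u(1)] y(2) u(2) by blast
  qed
qed

lemma boundary_eq_Union_smooth_coatoms_imp_class_C0: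
  fixes C :: "'a::euclidean_space set"
  assumes "proper_convex C" "C - interior C = \<Union>(smooth_coatoms C)"
  shows "class_C0 C"
proof -
  have C: "convex C" "interior C \<noteq> {}"
    using assms(1) by (auto simp: proper_convex_def)
  have "\<exists>R. exposed_ray N R \<and> R \<in> normal_cones C" if N: "proper_normal_cone C N" for N
  proof -
    obtain x where x: "x \<in> C - interior C" "N = normal_cone_at C x"
      using N proper_normal_cone_iff[OF C] by blast
    then obtain F where F: "F \<in> smooth_coatoms C" "x \<in> F" using assms(2) by blast
    then have face: "F face_of C" and ray: "ray (normal_cone C F)"
      by (auto simp: smooth_coatoms_def smooth_exposed_face_def exposed_faces_def
          exposed_face_of_def)
    have sub: "F \<subseteq> C" using face by (rule face_of_imp_subset)
    have "F \<noteq> {}" using F(2) by blast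
    obtain y where y: "y \<in> F" "normal_cone C F = normal_cone_at C y"
      and mono: "\<And>z. z \<in> F \<Longrightarrow> normal_cone_at C y \<subseteq> normal_cone_at C z"
      by (rule normal_cone_eq_at_point[OF face_of_imp_convex[OF face] sub \<open>F \<noteq> {}\<close>]) blast
    have "exposed_ray N (normal_cone_at C y)"
      using normal_cone_at_exposed_face_of_normal_cone_at[OF _ mono[OF F(2)]] x y ray sub
      by (auto simp: exposed_ray_def)
    then show ?thesis using y(1) sub by (auto simp: normal_cones_def)
  qed
  then show ?thesis using assms(1) by (simp add: class_C0_def)
qed

theorem theorem3p3:
  fixes C :: "(real ^ 'm) set"
  assumes "proper_convex C"
  shows "smooth_exposed_points C \<inter> \<Union>(smooth_lattice C - {C}) = {} \<and>
         (class_C0 C \<longleftrightarrow> C - interior C = \<Union>(smooth_coatoms C))"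
proof -
  have "convex C" "interior C \<noteq> {}" using assms by (simp_all add: proper_convex_def)
  then show ?thesis
    by (metis smooth_exposed_points_disjoint_smooth_lattice
        class_C0_imp_boundary_eq_Union_smooth_coatoms
        boundary_eq_Union_smooth_coatoms_imp_class_C0[OF assms])
qed

end
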